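(* Let $R$ be a commutative ring with unity with no nontrivial idempotents such that $\mathrm{Cl}(R)$ is not a complete graph. Then $\beta(\mathrm{Cl}(R)_{SR})=2$.
   Context: All rings are commutative with unity. $U(R)$ is the set of units, $\mathrm{Id}(R)$ the set of idempotents. The clean graph $\mathrm{Cl}(R)$ has vertex set $\{(e,u): e\in\mathrm{Id}(R), u\in U(R)\}$, two distinct vertices $(e,u),(f,v)$ being adjacent iff $ef=0$ or $uv=1$. In a connected graph $\Gamma$ with distance $d$ and neighbourhoods $N(x)$, $x$ is maximally distant from $y$ if $d(y,w)\le d(x,y)$ for all $w\in N(x)$, and $x,y$ are mutually maximally distant (MMD) if each is maximally distant from the other. The strong resolving graph $\Gamma_{SR}$ has as vertex set the vertices MMD with some vertex, two vertices adjacent iff MMD in $\Gamma$. $\beta$ denotes the independence number. *)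

theory Defs
  imports
    "HOL-Algebra.Ring"
    "HOL-Library.Extended_Nat"
    "Graph_Theory.Graph_Theory"
begin

text \<open>Undirected simple graphs are symmetric loop-free digraphs, as in the library; vertex sets
  may be infinite.\<close>

definition is_complete_graph :: "('a, 'b) pre_digraph \<Rightarrow> bool" where
  "is_complete_graph G \<longleftrightarrow>
     (\<forall>x \<in> verts G. \<forall>y \<in> verts G. x \<noteq> y \<longrightarrow> x \<rightarrow>\<^bsub>G\<^esub> y)"

text \<open>The length of a shortest walk, and \<open>\<infinity>\<close> if there is none.\<close>

definition graph_dist :: "('a, 'b) pre_digraph \<Rightarrow> 'a \<Rightarrow> 'a \<Rightarrow> ereal" where
  "graph_dist G = wf_digraph.\<mu> G (\<lambda>_. 1)"

definition neighbourhood :: "('a, 'b) pre_digraph \<Rightarrow> 'a \<Rightarrow> 'a set" where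
  "neighbourhood G x = {w. x \<rightarrow>\<^bsub>G\<^esub> w}"

definition maximally_distant :: "('a, 'b) pre_digraph \<Rightarrow> 'a \<Rightarrow> 'a \<Rightarrow> bool" where
  "maximally_distant G x y \<longleftrightarrow> (\<forall>w \<in> neighbourhood G x. graph_dist G y w \<le> graph_dist G x y)"

definition mutually_maximally_distant :: "('a, 'b) pre_digraph \<Rightarrow> 'a \<Rightarrow> 'a \<Rightarrow> bool" where
  "mutually_maximally_distant G x y \<longleftrightarrow> maximally_distant G x y \<and> maximally_distant G y x"

definition strong_resolving_graph :: "('a, 'b) pre_digraph \<Rightarrow> 'a pair_pre_digraph" where
  "strong_resolving_graph G =
     \<lparr> pverts = {x \<in> verts G. \<exists>y \<in> verts G. mutually_maximally_distant G x y},
       parcs = {(x, y). x \<in> verts G \<and> y \<in> verts G \<and> x \<noteq> y \<and> mutually_maximally_distant G x y} \<rparr>"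

definition independent_set :: "('a, 'b) pre_digraph \<Rightarrow> 'a set \<Rightarrow> bool" where
  "independent_set G S \<longleftrightarrow>
     S \<subseteq> verts G \<and> (\<forall>x \<in> S. \<forall>y \<in> S. x \<noteq> y \<longrightarrow> \<not> x \<rightarrow>\<^bsub>G\<^esub> y)"

text \<open>All infinite cardinalities are identified with \<open>\<infinity>\<close>; a finite value is the usual maximum.\<close>

definition independence_number :: "('a, 'b) pre_digraph \<Rightarrow> enat" where
  "independence_number G =
     (SUP S \<in> {S. independent_set G S}. if finite S then enat (card S) else \<infinity>)"

definition idempotents :: "('a, 'm) ring_scheme \<Rightarrow> 'a set" where
  "idempotents R = {e \<in> carrier R. e \<otimes>\<^bsub>R\<^esub> e = e}"

definition clean_graph :: "('a, 'm) ring_scheme \<Rightarrow> ('a \<times> 'a) pair_pre_digraph" where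
  "clean_graph R =
     \<lparr> pverts = idempotents R \<times> Units R,
       parcs = {((e, u), (f, v)).
         (e, u) \<in> idempotents R \<times> Units R \<and> (f, v) \<in> idempotents R \<times> Units R \<and>
         (e, u) \<noteq> (f, v) \<and> (e \<otimes>\<^bsub>R\<^esub> f = \<zero>\<^bsub>R\<^esub> \<or> u \<otimes>\<^bsub>R\<^esub> v = \<one>\<^bsub>R\<^esub>)} \<rparr>"

lemma (in cring) pair_bidirected_digraph_clean_graph: "pair_bidirected_digraph (clean_graph R)"
proof unfold_locales
  show "symmetric (with_proj (clean_graph R))"
    unfolding symmetric_def arcs_ends_def arc_to_ends_def clean_graph_def idempotents_def
    by (auto simp: sym_def image_iff m_comm Units_closed)
qed (auto simp: clean_graph_def)

lemma (in cring) strongly_connected_clean_graph: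
  "strongly_connected (with_proj (clean_graph R))"
proof -
  interpret G: pair_bidirected_digraph "clean_graph R"
    by (rule pair_bidirected_digraph_clean_graph)
  let ?G = "with_proj (clean_graph R)"
  let ?c = "(\<zero>, \<one>)"
  have c: "?c \<in> verts ?G"
    by (simp add: clean_graph_def idempotents_def)
  have to_c: "x \<rightarrow>\<^sup>*\<^bsub>?G\<^esub> ?c" if x: "x \<in> verts ?G" for x
  proof (cases "x = ?c")
    case True
    then show ?thesis using c by simp
  next
    case False
    then have "(x, ?c) \<in> parcs (clean_graph R)"
      using x c by (auto simp: clean_graph_def idempotents_def)
    then show ?thesis by (rule G.reachable_adjI)
  qed
  have "x \<rightarrow>\<^sup>*\<^bsub>?G\<^esub> y" if "x \<in> verts ?G" "y \<in> verts ?G" for x y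
    using to_c[OF that(1)] symmetric_reachable[OF G.sym_arcs to_c[OF that(2)]]
    by (rule G.reachable_trans)
  then show ?thesis
    using c unfolding strongly_connected_def by blast
qed

end

theory Submission
  imports Defs
begin

text \<open>The vertices \<open>(0, u)\<close> are adjacent to everything, so \<open>Cl(R)\<close> has diameter at most 2 and
  two distinct vertices are mutually maximally distant iff they are non-adjacent or twins. The
  vertices \<open>(0, u)\<close> are pairwise twins, and so are \<open>(1, u)\<close> and \<open>(1, u\<inverse>)\<close>, while all other pairs
  \<open>(1, u)\<close>, \<open>(1, v)\<close> are non-adjacent. If some \<open>(1, u)\<close> were adjacent to everything, then the only
  units would be \<open>u\<close> and \<open>u\<inverse>\<close> and the graph would be complete; hence no \<open>(0, u)\<close> is a twin of
  some \<open>(1, v)\<close>. So the strong resolving graph is a disjoint union of two cliques.\<close>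

context wf_digraph
begin

lemma graph_dist_eqI:
  assumes "awalk x p y" "length p = n" "\<And>q. awalk x q y \<Longrightarrow> n \<le> length q"
  shows "graph_dist G x y = ereal n"
proof -
  have "awalk_cost (\<lambda>_. 1) q = length q" for q
    by (simp add: awalk_cost_def sum_list_triv)
  then show ?thesis
    using assms unfolding graph_dist_def \<mu>_def
    by (intro antisym INF_lower2[of p] INF_greatest) auto
qed

lemma graph_dist_self:
  assumes "x \<in> verts G"
  shows "graph_dist G x x = 0"
  using graph_dist_eqI[of x "[]" x 0] assms by (simp add: awalk_Nil_iff zero_ereal_def)

lemma graph_dist_adj:
  assumes "x \<rightarrow>\<^bsub>G\<^esub> y" "x \<noteq> y"
  shows "graph_dist G x y = 1"
proof -
  obtain a where "a \<in> arcs G" "tail G a = x" "head G a = y"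
    using assms(1) by (auto simp: arcs_ends_conv)
  then have "awalk x [a] y"
    by (auto simp: awalk_simps)
  moreover have "1 \<le> length q" if "awalk x q y" for q
    using that assms(2) by (cases q) (auto simp: awalk_simps)
  ultimately show ?thesis
    using graph_dist_eqI[of x "[a]" y 1] by (simp add: one_ereal_def)
qed

lemma graph_dist_common_neighbour:
  assumes "x \<rightarrow>\<^bsub>G\<^esub> z" "z \<rightarrow>\<^bsub>G\<^esub> y" "x \<noteq> y" "\<not> x \<rightarrow>\<^bsub>G\<^esub> y"
  shows "graph_dist G x y = 2"
proof -
  obtain a b where "a \<in> arcs G" "tail G a = x" "head G a = z"
    and "b \<in> arcs G" "tail G b = z" "head G b = y"
    using assms(1,2) by (auto simp: arcs_ends_conv)
  then have "awalk x [a, b] y"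
    by (auto simp: awalk_simps)
  moreover have "2 \<le> length q" if "awalk x q y" for q
    using that assms(3,4)
    by (cases q rule: remdups_adj.cases) (auto simp: awalk_simps dest: in_arcs_imp_in_arcs_ends)
  ultimately show ?thesis
    using graph_dist_eqI[of x "[a, b]" y 2] by simp
qed

end

definition universal_vertex :: "('a, 'b) pre_digraph \<Rightarrow> 'a \<Rightarrow> bool" where
  "universal_vertex G c \<longleftrightarrow> c \<in> verts G \<and> (\<forall>x \<in> verts G - {c}. c \<rightarrow>\<^bsub>G\<^esub> x)"

definition twins :: "('a, 'b) pre_digraph \<Rightarrow> 'a \<Rightarrow> 'a \<Rightarrow> bool" where
  "twins G x y \<longleftrightarrow> (\<forall>w \<in> verts G - {x, y}. x \<rightarrow>\<^bsub>G\<^esub> w \<longleftrightarrow> y \<rightarrow>\<^bsub>G\<^esub> w)"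

lemma mutually_maximally_distant_commute:
  "mutually_maximally_distant G x y \<longleftrightarrow> mutually_maximally_distant G y x"
  by (auto simp: mutually_maximally_distant_def)

context sym_digraph
begin

lemma graph_dist_of_universal_vertex:
  assumes "universal_vertex G c" "x \<in> verts G" "y \<in> verts G"
  shows "graph_dist G x y = (if x = y then 0 else if x \<rightarrow>\<^bsub>G\<^esub> y then 1 else 2)"
proof -
  consider (equal) "x = y" | (adjacent) "x \<noteq> y" "x \<rightarrow>\<^bsub>G\<^esub> y"
    | (nonadjacent) "x \<noteq> y" "\<not> x \<rightarrow>\<^bsub>G\<^esub> y"
    by blast
  then show ?thesis
  proof cases
    case nonadjacent
    then have "x \<rightarrow>\<^bsub>G\<^esub> c" "c \<rightarrow>\<^bsub>G\<^esub> y"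
      using assms graph_symmetric unfolding universal_vertex_def by blast+
    then show ?thesis
      using nonadjacent by (simp add: graph_dist_common_neighbour)
  qed (use assms in \<open>simp_all add: graph_dist_self graph_dist_adj\<close>)
qed

lemma maximally_distant_iff:
  assumes universal: "universal_vertex G c"
    and distinct_verts: "x \<in> verts G" "y \<in> verts G" "x \<noteq> y"
  shows "maximally_distant G x y \<longleftrightarrow>
    \<not> x \<rightarrow>\<^bsub>G\<^esub> y \<or> (\<forall>w \<in> verts G - {x, y}. x \<rightarrow>\<^bsub>G\<^esub> w \<longrightarrow> y \<rightarrow>\<^bsub>G\<^esub> w)"
proof -
  have "graph_dist G y w \<le> graph_dist G x y \<longleftrightarrow> \<not> x \<rightarrow>\<^bsub>G\<^esub> y \<or> w = y \<or> y \<rightarrow>\<^bsub>G\<^esub> w"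
    if "x \<rightarrow>\<^bsub>G\<^esub> w" for w
    using distinct_verts adj_in_verts(2)[OF that]
    by (auto simp: graph_dist_of_universal_vertex[OF universal])
  then show ?thesis
    using adj_in_verts(2) graph_symmetric
    unfolding maximally_distant_def neighbourhood_def by blast
qed

lemma mutually_maximally_distant_iff_nonadjacent_or_twins:
  assumes "universal_vertex G c" "x \<in> verts G" "y \<in> verts G" "x \<noteq> y"
  shows "mutually_maximally_distant G x y \<longleftrightarrow> \<not> x \<rightarrow>\<^bsub>G\<^esub> y \<or> twins G x y"
  using assms maximally_distant_iff[of c x y] maximally_distant_iff[of c y x] graph_symmetric
  unfolding mutually_maximally_distant_def twins_def by blast

lemma mutually_maximally_distant_universal_vertex_iff:
  assumes "universal_vertex G x" "y \<in> verts G" "x \<noteq> y"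
  shows "mutually_maximally_distant G x y \<longleftrightarrow> universal_vertex G y"
proof -
  have "x \<in> verts G" "x \<rightarrow>\<^bsub>G\<^esub> y" "y \<rightarrow>\<^bsub>G\<^esub> x"
    using assms graph_symmetric unfolding universal_vertex_def by blast+
  then have "universal_vertex G y \<longleftrightarrow> twins G x y"
    using assms by (auto simp: universal_vertex_def twins_def)
  then show ?thesis
    using mutually_maximally_distant_iff_nonadjacent_or_twins[OF assms(1)] assms
      \<open>x \<in> verts G\<close> \<open>x \<rightarrow>\<^bsub>G\<^esub> y\<close>
    by simp
qed

end

definition ecard :: "'a set \<Rightarrow> enat" where
  "ecard S = (if finite S then enat (card S) else \<infinity>)"

lemma ecard_mono: "S \<subseteq> T \<Longrightarrow> ecard S \<le> ecard T"
  by (auto simp: ecard_def card_mono dest: finite_subset)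

lemma ecard_image: "inj_on f S \<Longrightarrow> ecard (f ` S) = ecard S"
  by (simp add: ecard_def card_image finite_image_iff)

lemma independence_number_disjoint_union_of_cliques:
  assumes adj_iff: "\<And>x y. x \<in> verts G \<Longrightarrow> y \<in> verts G \<Longrightarrow> x \<noteq> y \<Longrightarrow> x \<rightarrow>\<^bsub>G\<^esub> y \<longleftrightarrow> f x = f y"
  shows "independence_number G = ecard (f ` verts G)"
proof -
  have independent_iff: "independent_set G S \<longleftrightarrow> S \<subseteq> verts G \<and> inj_on f S" for S
    using adj_iff unfolding independent_set_def inj_on_def by blast
  have "independence_number G = (SUP S \<in> {S. independent_set G S}. ecard S)"
    by (simp add: independence_number_def ecard_def)
  also have "\<dots> = ecard (f ` verts G)"
  proof (rule antisym)
    show "(SUP S \<in> {S. independent_set G S}. ecard S) \<le> ecard (f ` verts G)"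
    proof (rule SUP_least)
      fix S
      assume "S \<in> {S. independent_set G S}"
      then have "S \<subseteq> verts G" "inj_on f S"
        by (simp_all add: independent_iff)
      then show "ecard S \<le> ecard (f ` verts G)"
        by (metis ecard_image ecard_mono image_mono)
    qed
    obtain S where "S \<subseteq> verts G" "inj_on f S" "f ` S = f ` verts G"
      by (metis order_refl subset_image_inj)
    then show "ecard (f ` verts G) \<le> (SUP S \<in> {S. independent_set G S}. ecard S)"
      by (intro SUP_upper2[of S]) (simp_all add: independent_iff flip: ecard_image)
  qed
  finally show ?thesis .
qed

context cring
begin

abbreviation Cl :: "('a \<times> 'a, ('a \<times> 'a) \<times> ('a \<times> 'a)) pre_digraph" where
  "Cl \<equiv> with_proj (clean_graph R)"

lemma sym_digraph_clean_graph: "sym_digraph Cl"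
proof -
  interpret pair_bidirected_digraph "clean_graph R"
    by (rule pair_bidirected_digraph_clean_graph)
  show ?thesis by unfold_locales
qed

lemma pverts_clean_graph: "pverts (clean_graph R) = idempotents R \<times> Units R"
  by (simp add: clean_graph_def)

lemma universal_vertex_zero:
  assumes "u \<in> Units R"
  shows "universal_vertex Cl (\<zero>, u)"
  using assms by (auto simp: universal_vertex_def clean_graph_def idempotents_def)

lemma clean_graph_complete_if_one_eq_zero:
  assumes "\<one> = \<zero>"
  shows "is_complete_graph Cl"
proof -
  have "e \<otimes> f = \<zero>" if "e \<in> idempotents R" "f \<in> idempotents R" for e f
    using that one_zeroD[OF assms] by (auto simp: idempotents_def)
  then show ?thesis
    by (auto simp: is_complete_graph_def clean_graph_def)
qed

end

locale trivial_idempotents_cring = cring R for R :: "('a, 'm) ring_scheme" (structure) +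
  assumes idempotents_eq: "idempotents R = {\<zero>, \<one>}"
begin

interpretation Cl: sym_digraph Cl
  by (rule sym_digraph_clean_graph)

lemma twins_one_inverse_units:
  assumes "u \<in> Units R" "v \<in> Units R" "u \<otimes> v = \<one>"
  shows "twins Cl (\<one>, u) (\<one>, v)"
  unfolding twins_def
proof
  fix w
  assume "w \<in> verts Cl - {(\<one>, u), (\<one>, v)}"
  then obtain f t where w_vertex: "w = (f, t)" "f \<in> {\<zero>, \<one>}" "t \<in> Units R"
    and t_distinct: "f = \<one> \<Longrightarrow> t \<noteq> u \<and> t \<noteq> v"
    by (auto simp: pverts_clean_graph idempotents_eq)
  have "u \<otimes> t = \<one> \<longleftrightarrow> t = v" "v \<otimes> t = \<one> \<longleftrightarrow> t = u"
    using assms w_vertex(3) by (metis Units_closed comm_inv_char m_comm)+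
  then show "(\<one>, u) \<rightarrow>\<^bsub>Cl\<^esub> w \<longleftrightarrow> (\<one>, v) \<rightarrow>\<^bsub>Cl\<^esub> w"
    using w_vertex t_distinct assms by (auto simp: clean_graph_def idempotents_eq)
qed

lemma clean_graph_complete_if_universal_vertex_one:
  assumes "universal_vertex Cl (\<one>, u)"
  shows "is_complete_graph Cl"
proof (cases "\<one> = \<zero>")
  case True
  then show ?thesis by (rule clean_graph_complete_if_one_eq_zero)
next
  case False
  have u_unit: "u \<in> Units R"
    using assms by (simp add: universal_vertex_def pverts_clean_graph)
  have eq_or_eq_inv: "w = u \<or> w = inv u" if "w \<in> Units R" for w
  proof (cases "w = u")
    case False
    then have "(\<one>, u) \<rightarrow>\<^bsub>Cl\<^esub> (\<one>, w)"
      using assms that by (auto simp: universal_vertex_def pverts_clean_graph idempotents_eq)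
    then have "u \<otimes> w = \<one>"
      using \<open>\<one> \<noteq> \<zero>\<close> u_unit that by (simp add: clean_graph_def)
    then show ?thesis
      using u_unit that comm_inv_char[of u w] by (simp add: Units_closed)
  qed simp
  have "s \<otimes> t = \<one>" if "s \<in> Units R" "t \<in> Units R" "s \<noteq> t" for s t
    using eq_or_eq_inv[OF that(1)] eq_or_eq_inv[OF that(2)] that(3) u_unit by auto
  then show ?thesis
    by (auto simp: is_complete_graph_def clean_graph_def idempotents_eq)
qed

end

locale noncomplete_clean_graph_cring = trivial_idempotents_cring +
  assumes not_complete: "\<not> is_complete_graph Cl"
begin

interpretation Cl: sym_digraph Cl
  by (rule sym_digraph_clean_graph)

lemma one_not_zero: "\<one> \<noteq> \<zero>"
  using not_complete clean_graph_complete_if_one_eq_zero by blast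

lemma not_universal_vertex_one: "\<not> universal_vertex Cl (\<one>, u)"
  using not_complete clean_graph_complete_if_universal_vertex_one by blast

lemma ex_other_unit:
  assumes "u \<in> Units R"
  shows "\<exists>v \<in> Units R. v \<noteq> u"
proof -
  have "(\<one>, u) \<in> verts Cl"
    using assms by (simp add: pverts_clean_graph idempotents_eq)
  then obtain w where "w \<in> verts Cl" "w \<noteq> (\<one>, u)" "\<not> (\<one>, u) \<rightarrow>\<^bsub>Cl\<^esub> w"
    using not_universal_vertex_one[of u] unfolding universal_vertex_def by blast
  then have "snd w \<in> Units R" "snd w \<noteq> u"
    using assms by (auto simp: clean_graph_def idempotents_eq)
  then show ?thesis by blast
qed

lemma mutually_maximally_distant_one:
  assumes "u \<in> Units R" "v \<in> Units R" "u \<noteq> v"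
  shows "mutually_maximally_distant Cl (\<one>, u) (\<one>, v)"
proof -
  have "\<not> (\<one>, u) \<rightarrow>\<^bsub>Cl\<^esub> (\<one>, v) \<or> twins Cl (\<one>, u) (\<one>, v)"
    using assms one_not_zero twins_one_inverse_units by (auto simp: clean_graph_def)
  then show ?thesis
    using Cl.mutually_maximally_distant_iff_nonadjacent_or_twins[OF universal_vertex_zero] assms
    by (simp add: pverts_clean_graph idempotents_eq)
qed

lemma mutually_maximally_distant_zero_iff:
  assumes "u \<in> Units R" "(f, v) \<in> verts Cl" "(\<zero>, u) \<noteq> (f, v)"
  shows "mutually_maximally_distant Cl (\<zero>, u) (f, v) \<longleftrightarrow> f = \<zero>"
proof -
  have "universal_vertex Cl (f, v) \<longleftrightarrow> f = \<zero>"
    using assms(2) universal_vertex_zero not_universal_vertex_one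
    by (auto simp: pverts_clean_graph idempotents_eq)
  then show ?thesis
    using Cl.mutually_maximally_distant_universal_vertex_iff[OF universal_vertex_zero] assms
    by simp
qed

lemma mutually_maximally_distant_clean_graph_iff:
  assumes "x \<in> verts Cl" "y \<in> verts Cl" "x \<noteq> y"
  shows "mutually_maximally_distant Cl x y \<longleftrightarrow> fst x = fst y"
proof -
  obtain e u f v where pairs: "x = (e, u)" "y = (f, v)"
    by fastforce
  then consider (left_zero) "e = \<zero>" | (right_zero) "f = \<zero>" | (both_one) "e = \<one>" "f = \<one>"
    using assms by (auto simp: pverts_clean_graph idempotents_eq)
  then show ?thesis
  proof cases
    case left_zero
    then show ?thesis
      using assms pairs mutually_maximally_distant_zero_iff[of u f v]
      by (auto simp: pverts_clean_graph)
  next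
    case right_zero
    have "mutually_maximally_distant Cl x y \<longleftrightarrow> mutually_maximally_distant Cl y x"
      by (rule mutually_maximally_distant_commute)
    also have "\<dots> \<longleftrightarrow> fst x = fst y"
      using right_zero assms pairs mutually_maximally_distant_zero_iff[of v e u]
      by (auto simp: pverts_clean_graph)
    finally show ?thesis .
  next
    case both_one
    then show ?thesis
      using assms pairs mutually_maximally_distant_one[of u v] by (simp add: pverts_clean_graph)
  qed
qed

lemma pverts_strong_resolving_graph_clean_graph:
  "pverts (strong_resolving_graph Cl) = pverts (clean_graph R)"
proof -
  have "\<exists>y \<in> verts Cl. mutually_maximally_distant Cl x y"
    if x_vert: "x \<in> verts Cl" for x
  proof -
    obtain e u where "x = (e, u)" "e \<in> idempotents R" "u \<in> Units R"
      using x_vert by (auto simp: pverts_clean_graph)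
    moreover obtain v where "v \<in> Units R" "v \<noteq> u"
      using ex_other_unit[OF \<open>u \<in> Units R\<close>] by blast
    ultimately show ?thesis
      using mutually_maximally_distant_clean_graph_iff[of x "(e, v)"]
      by (intro bexI[of _ "(e, v)"]) (auto simp: pverts_clean_graph)
  qed
  then show ?thesis by (auto simp: strong_resolving_graph_def)
qed

end

theorem theorem3p10:
  fixes R :: "('a, 'm) ring_scheme" (structure)
  assumes "cring R"
    and "idempotents R = {\<zero>, \<one>}"
    and "\<not> is_complete_graph (with_proj (clean_graph R))"
  shows "independence_number
           (with_proj (strong_resolving_graph (with_proj (clean_graph R)))) = 2"
proof -
  interpret cring R by fact
  interpret noncomplete_clean_graph_cring R
    by unfold_locales fact+
  let ?SR = "with_proj (strong_resolving_graph Cl)"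
  have "independence_number ?SR = ecard (fst ` verts ?SR)"
    by (rule independence_number_disjoint_union_of_cliques)
      (simp add: strong_resolving_graph_def mutually_maximally_distant_clean_graph_iff)
  also have "fst ` verts ?SR = {\<zero>, \<one>}"
    using Units_one_closed
    by (auto simp: pverts_strong_resolving_graph_clean_graph pverts_clean_graph idempotents_eq)
  also have "ecard {\<zero>, \<one>} = 2"
    using one_not_zero by (simp add: ecard_def numeral_eq_enat)
  finally show ?thesis .
qed

end
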